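(* Let $(G,N,\odot)$ be a reduced skew bracoid and let $A=\lambda_\odot(G)\subseteq\mathrm{Hol}(N)$. The following are equivalent: (i) $A$ is of the form $R\rtimes B$ where $R$ is a regular subgroup of $\mathrm{Hol}(N)$ and $B$ is some subgroup of $\mathrm{Aut}(N)$; (ii) the skew bracoid $(G,N,\odot)$ is almost a brace.
   Context: A skew bracoid $(G,\cdot,N,\star,\odot)$, written $(G,N,\odot)$, consists of two groups $(G,\cdot)$ and $(N,\star)$ and a transitive action $\odot$ of $G$ on the set $N$ such that $g\odot(\eta_1\star\eta_2)=(g\odot\eta_1)\star(g\odot e_N)^{-1}\star(g\odot\eta_2)$ for all $g\in G$, $\eta_1,\eta_2\in N$. It is almost a brace if $S=\mathrm{Stab}_G(e_N)$ has a normal complement $H$ in $G$ (i.e. $H$ is a normal subgroup of $G$ with $G=HS$ and $H\cap S$ trivial). It is reduced if the action $\odot$ is faithful. $\mathrm{Hol}(N)=N\rtimes\mathrm{Aut}(N)$ with product $(\eta_1,\theta_1)(\eta_2,\theta_2)=(\eta_1\theta_1(\eta_2),\theta_1\theta_2)$, acting on the set $N$ by $(\eta,\theta)\mu=\eta\theta(\mu)$; $\mathrm{Aut}(N)$ is identified with the subgroup $\{(e_N,\theta)\}$. A subgroup of $\mathrm{Hol}(N)$ is regular if it acts regularly (simply transitively) on $N$. The map $\gamma:G\to\mathrm{Aut}(N)$ is the homomorphism $\gamma(g)(\eta)=(g\odot e_N)^{-1}\star(g\odot\eta)$, and $\lambda_\odot:G\to\mathrm{Hol}(N)$ is the homomorphism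 $g\mapsto(g\odot e_N,\gamma(g))$, so that $\lambda_\odot(g)$ acts on $N$ as $\eta\mapsto g\odot\eta$. "$A$ is of the form $R\rtimes B$" means that $R$ and $B$ are subgroups of $A$ with $R$ normal in $A$, $A=RB$ and $R\cap B$ trivial. *)

theory Defs
  imports "HOL-Algebra.Group_Action"
begin

section \<open>Internal semidirect products\<close>

text \<open>\<open>G\<close> is the internal semidirect product of its normal subgroup \<open>R\<close> and its subgroup \<open>B\<close>;
  equivalently, \<open>R\<close> is a normal complement of \<open>B\<close> in \<open>G\<close>.\<close>

definition internal_semidirect :: "('a, 'c) monoid_scheme \<Rightarrow> 'a set \<Rightarrow> 'a set \<Rightarrow> bool"
  where "internal_semidirect G R B \<longleftrightarrow>
    R \<lhd> G \<and> subgroup B G \<and> carrier G = R <#>\<^bsub>G\<^esub> B \<and> R \<inter> B = {\<one>\<^bsub>G\<^esub>}"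


section \<open>The holomorph\<close>

definition hol :: "('b, 'd) monoid_scheme \<Rightarrow> ('b \<times> ('b \<Rightarrow> 'b)) monoid"
  where "hol N =
    \<lparr>carrier = carrier N \<times> carrier (AutoGroup N),
     mult = (\<lambda>(\<eta>1, \<theta>1) (\<eta>2, \<theta>2). (\<eta>1 \<otimes>\<^bsub>N\<^esub> \<theta>1 \<eta>2, \<theta>1 \<otimes>\<^bsub>AutoGroup N\<^esub> \<theta>2)),
     one = (\<one>\<^bsub>N\<^esub>, \<one>\<^bsub>AutoGroup N\<^esub>)\<rparr>"

text \<open>As in \<^const>\<open>BijGroup\<close>, permutations of \<open>carrier N\<close> are extensional functions.\<close>

definition hol_act :: "('b, 'd) monoid_scheme \<Rightarrow> 'b \<times> ('b \<Rightarrow> 'b) \<Rightarrow> 'b \<Rightarrow> 'b"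
  where "hol_act N = (\<lambda>(\<eta>, \<theta>). \<lambda>\<mu>\<in>carrier N. \<eta> \<otimes>\<^bsub>N\<^esub> \<theta> \<mu>)"

definition hol_aut :: "('b, 'd) monoid_scheme \<Rightarrow> ('b \<times> ('b \<Rightarrow> 'b)) set"
  where "hol_aut N = {\<one>\<^bsub>N\<^esub>} \<times> carrier (AutoGroup N)"

definition regular_subgroup :: "('b \<times> ('b \<Rightarrow> 'b)) set \<Rightarrow> ('b, 'd) monoid_scheme \<Rightarrow> bool"
  where "regular_subgroup R N \<longleftrightarrow>
    subgroup R (hol N) \<and>
    (\<forall>\<mu>\<in>carrier N. \<forall>\<nu>\<in>carrier N. \<exists>!r. r \<in> R \<and> hol_act N r \<mu> = \<nu>)"


section \<open>Skew bracoids\<close>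

locale skew_bracoid =
  G: group G + N: group N + transitive_action G "carrier N" act
  for G :: "('a, 'c) monoid_scheme" and N :: "('b, 'd) monoid_scheme"
    and act :: "'a \<Rightarrow> 'b \<Rightarrow> 'b" +
  assumes act_mult:
    "\<lbrakk>g \<in> carrier G; \<eta>1 \<in> carrier N; \<eta>2 \<in> carrier N\<rbrakk> \<Longrightarrow>
      act g (\<eta>1 \<otimes>\<^bsub>N\<^esub> \<eta>2) = act g \<eta>1 \<otimes>\<^bsub>N\<^esub> inv\<^bsub>N\<^esub> (act g \<one>\<^bsub>N\<^esub>) \<otimes>\<^bsub>N\<^esub> act g \<eta>2"

locale reduced_skew_bracoid =
  skew_bracoid G N act + faithful_action G "carrier N" act
  for G :: "('a, 'c) monoid_scheme" and N :: "('b, 'd) monoid_scheme"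
    and act :: "'a \<Rightarrow> 'b \<Rightarrow> 'b"

locale almost_brace =
  skew_bracoid G N act
  for G :: "('a, 'c) monoid_scheme" and N :: "('b, 'd) monoid_scheme"
    and act :: "'a \<Rightarrow> 'b \<Rightarrow> 'b" +
  assumes normal_complement: "\<exists>H. internal_semidirect G H (stabilizer G act \<one>\<^bsub>N\<^esub>)"

definition bracoid_gamma :: "('b, 'd) monoid_scheme \<Rightarrow> ('a \<Rightarrow> 'b \<Rightarrow> 'b) \<Rightarrow> 'a \<Rightarrow> 'b \<Rightarrow> 'b"
  where "bracoid_gamma N act g = (\<lambda>\<eta>\<in>carrier N. inv\<^bsub>N\<^esub> (act g \<one>\<^bsub>N\<^esub>) \<otimes>\<^bsub>N\<^esub> act g \<eta>)"

definition bracoid_lambda ::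
    "('b, 'd) monoid_scheme \<Rightarrow> ('a \<Rightarrow> 'b \<Rightarrow> 'b) \<Rightarrow> 'a \<Rightarrow> 'b \<times> ('b \<Rightarrow> 'b)"
  where "bracoid_lambda N act g = (act g \<one>\<^bsub>N\<^esub>, bracoid_gamma N act g)"


section \<open>Basic facts\<close>

lemma AutoGroup_simps:
  "carrier (AutoGroup N) = auto N"
  "\<one>\<^bsub>AutoGroup N\<^esub> = (\<lambda>x\<in>carrier N. x)"
  "\<lbrakk>f \<in> auto N; g \<in> auto N\<rbrakk> \<Longrightarrow> f \<otimes>\<^bsub>AutoGroup N\<^esub> g = compose (carrier N) f g"
  by (auto simp: AutoGroup_def BijGroup_def auto_def)

lemma hol_simps:
  "carrier (hol N) = carrier N \<times> carrier (AutoGroup N)"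
  "(\<eta>1, \<theta>1) \<otimes>\<^bsub>hol N\<^esub> (\<eta>2, \<theta>2) = (\<eta>1 \<otimes>\<^bsub>N\<^esub> \<theta>1 \<eta>2, \<theta>1 \<otimes>\<^bsub>AutoGroup N\<^esub> \<theta>2)"
  "\<one>\<^bsub>hol N\<^esub> = (\<one>\<^bsub>N\<^esub>, \<one>\<^bsub>AutoGroup N\<^esub>)"
  by (simp_all add: hol_def)

lemma autoD:
  assumes "f \<in> auto N"
  shows "x \<in> carrier N \<Longrightarrow> f x \<in> carrier N"
    and "\<lbrakk>x \<in> carrier N; y \<in> carrier N\<rbrakk> \<Longrightarrow> f (x \<otimes>\<^bsub>N\<^esub> y) = f x \<otimes>\<^bsub>N\<^esub> f y"
  using assms by (auto simp: auto_def hom_def)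

theorem (in group) group_hol: "group (hol G)"
proof -
  interpret A: group "AutoGroup G" by (rule AutoGroup)
  show ?thesis
  proof (rule groupI)
    fix x y assume "x \<in> carrier (hol G)" "y \<in> carrier (hol G)"
    then show "x \<otimes>\<^bsub>hol G\<^esub> y \<in> carrier (hol G)"
      using A.m_closed by (auto simp: hol_simps AutoGroup_simps(1) autoD(1))
  next
    show "\<one>\<^bsub>hol G\<^esub> \<in> carrier (hol G)"
      using A.one_closed by (simp add: hol_simps)
  next
    fix x y z assume "x \<in> carrier (hol G)" "y \<in> carrier (hol G)" "z \<in> carrier (hol G)"
    then obtain a f b g c h where [simp]: "x = (a, f)" "y = (b, g)" "z = (c, h)"
      and car: "a \<in> carrier G" "b \<in> carrier G" "c \<in> carrier G"
      and aut: "f \<in> auto G" "g \<in> auto G" "h \<in> auto G"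
      by (auto simp: hol_simps AutoGroup_simps(1))
    have "f \<otimes>\<^bsub>AutoGroup G\<^esub> g \<otimes>\<^bsub>AutoGroup G\<^esub> h = f \<otimes>\<^bsub>AutoGroup G\<^esub> (g \<otimes>\<^bsub>AutoGroup G\<^esub> h)"
      using aut by (intro A.m_assoc) (simp_all add: AutoGroup_simps(1))
    moreover have "(f \<otimes>\<^bsub>AutoGroup G\<^esub> g) c = f (g c)"
      using aut car by (simp add: AutoGroup_simps compose_eq)
    ultimately show "x \<otimes>\<^bsub>hol G\<^esub> y \<otimes>\<^bsub>hol G\<^esub> z = x \<otimes>\<^bsub>hol G\<^esub> (y \<otimes>\<^bsub>hol G\<^esub> z)"
      using car aut by (simp add: hol_simps autoD m_assoc)
  next
    fix x assume "x \<in> carrier (hol G)"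
    then obtain a f where [simp]: "x = (a, f)"
      and car: "a \<in> carrier G" and aut: "f \<in> carrier (AutoGroup G)"
      by (auto simp: hol_simps)
    have "\<one>\<^bsub>AutoGroup G\<^esub> \<otimes>\<^bsub>AutoGroup G\<^esub> f = f" using aut by (rule A.l_one)
    moreover have "\<one>\<^bsub>AutoGroup G\<^esub> a = a" using car by (simp add: AutoGroup_simps)
    ultimately show "\<one>\<^bsub>hol G\<^esub> \<otimes>\<^bsub>hol G\<^esub> x = x"
      using car by (simp add: hol_simps)
    let ?f = "inv\<^bsub>AutoGroup G\<^esub> f"
    have inv_f: "?f \<in> carrier (AutoGroup G)" using aut by (rule A.inv_closed)
    have inv_fa: "?f a \<in> carrier G"
      using inv_f car by (simp add: AutoGroup_simps(1) autoD(1))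
    have "(inv (?f a), ?f) \<otimes>\<^bsub>hol G\<^esub> x = \<one>\<^bsub>hol G\<^esub>"
      using inv_fa aut by (simp add: hol_simps)
    moreover have "(inv (?f a), ?f) \<in> carrier (hol G)"
      using inv_fa inv_f by (simp add: hol_simps)
    ultimately show "\<exists>y\<in>carrier (hol G). y \<otimes>\<^bsub>hol G\<^esub> x = \<one>\<^bsub>hol G\<^esub>" by blast
  qed
qed

context skew_bracoid
begin

lemma act_closed: "\<lbrakk>g \<in> carrier G; \<eta> \<in> carrier N\<rbrakk> \<Longrightarrow> act g \<eta> \<in> carrier N"
  using element_image by blast

lemma hol_act_lambda:
  assumes g: "g \<in> carrier G"
  shows "hol_act N (bracoid_lambda N act g) = act g"
proof
  fix \<eta>
  have "act g \<in> extensional (carrier N)"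
    using bij_prop0[OF g] by (simp add: Bij_def)
  then have "act g \<eta> = undefined" if "\<eta> \<notin> carrier N"
    using that by (rule extensional_arb)
  then show "hol_act N (bracoid_lambda N act g) \<eta> = act g \<eta>"
    using g by (cases "\<eta> \<in> carrier N")
      (simp_all add: hol_act_def bracoid_lambda_def bracoid_gamma_def act_closed
        N.m_assoc[symmetric])
qed

lemma gamma_auto:
  assumes g: "g \<in> carrier G"
  shows "bracoid_gamma N act g \<in> carrier (AutoGroup N)"
proof -
  let ?c = "act g \<one>\<^bsub>N\<^esub>"
  have c: "?c \<in> carrier N" using g by (simp add: act_closed)
  have "bracoid_gamma N act g \<in> hom N N"
    using g c by (auto simp: hom_def bracoid_gamma_def act_closed act_mult N.m_assoc)
  moreover have "bij_betw (bracoid_gamma N act g) (carrier N) (carrier N)"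
  proof -
    have inj: "inj_on (bracoid_gamma N act g) (carrier N)"
    proof (rule inj_onI)
      fix x y assume xy: "x \<in> carrier N" "y \<in> carrier N"
        and "bracoid_gamma N act g x = bracoid_gamma N act g y"
      then have "act g x = act g y"
        using g c by (simp add: bracoid_gamma_def act_closed)
      with xy show "x = y" using inj_prop[OF g] by (simp add: inj_on_eq_iff)
    qed
    have "\<exists>x\<in>carrier N. y = bracoid_gamma N act g x" if y: "y \<in> carrier N" for y
    proof -
      have "?c \<otimes>\<^bsub>N\<^esub> y \<in> act g ` carrier N"
        using y c surj_prop[OF g] by simp
      then obtain x where x: "x \<in> carrier N" "?c \<otimes>\<^bsub>N\<^esub> y = act g x" by blast
      have "bracoid_gamma N act g x = y"
        using x(1) y c by (simp add: bracoid_gamma_def x(2)[symmetric] N.m_assoc[symmetric])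
      with x(1) show ?thesis by blast
    qed
    moreover have "bracoid_gamma N act g \<in> carrier N \<rightarrow> carrier N"
      using g c by (simp add: bracoid_gamma_def act_closed)
    ultimately show ?thesis using inj by (auto simp: bij_betw_def)
  qed
  ultimately show ?thesis
    by (simp add: AutoGroup_simps auto_def Bij_def bracoid_gamma_def)
qed

lemma lambda_hom: "bracoid_lambda N act \<in> hom G (hol N)"
proof (rule homI)
  fix g assume "g \<in> carrier G"
  then show "bracoid_lambda N act g \<in> carrier (hol N)"
    by (simp add: bracoid_lambda_def hol_simps gamma_auto act_closed)
next
  fix g h assume g: "g \<in> carrier G" and h: "h \<in> carrier G"
  let ?c = "act g \<one>\<^bsub>N\<^esub>" and ?d = "act h \<one>\<^bsub>N\<^esub>"
  have aut: "bracoid_gamma N act g \<in> auto N" "bracoid_gamma N act h \<in> auto N"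
    using gamma_auto g h by (auto simp: AutoGroup_simps)
  have c: "?c \<in> carrier N" and d: "?d \<in> carrier N"
    using g h by (simp_all add: act_closed)
  have gd: "act g ?d = ?c \<otimes>\<^bsub>N\<^esub> bracoid_gamma N act g ?d"
    using g c d by (simp add: bracoid_gamma_def act_closed N.m_assoc[symmetric])
  have "bracoid_gamma N act (g \<otimes>\<^bsub>G\<^esub> h) =
      compose (carrier N) (bracoid_gamma N act g) (bracoid_gamma N act h)"
  proof
    fix x
    show "bracoid_gamma N act (g \<otimes>\<^bsub>G\<^esub> h) x =
      compose (carrier N) (bracoid_gamma N act g) (bracoid_gamma N act h) x"
    proof (cases "x \<in> carrier N")
      case False
      then show ?thesis by (simp add: bracoid_gamma_def compose_def)
    next
      case x: True
      let ?y = "bracoid_gamma N act h x"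
      have y: "?y \<in> carrier N" using aut x by (simp add: autoD)
      have hx: "act h x = ?d \<otimes>\<^bsub>N\<^esub> ?y"
        using x d h by (simp add: bracoid_gamma_def act_closed N.m_assoc[symmetric])
      have "bracoid_gamma N act (g \<otimes>\<^bsub>G\<^esub> h) x =
          inv\<^bsub>N\<^esub> (act g ?d) \<otimes>\<^bsub>N\<^esub> act g (?d \<otimes>\<^bsub>N\<^esub> ?y)"
        unfolding hx[symmetric] using x g h by (simp add: bracoid_gamma_def composition_rule)
      also have "\<dots> = inv\<^bsub>N\<^esub> ?c \<otimes>\<^bsub>N\<^esub> act g ?y"
        using g c d y by (simp add: act_mult act_closed N.m_assoc[symmetric])
      finally show ?thesis
        using x y by (simp add: compose_eq bracoid_gamma_def[of N act g])
    qed
  qed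
  then show "bracoid_lambda N act (g \<otimes>\<^bsub>G\<^esub> h) =
      bracoid_lambda N act g \<otimes>\<^bsub>hol N\<^esub> bracoid_lambda N act h"
    using g h aut by (simp add: bracoid_lambda_def hol_simps AutoGroup_simps composition_rule gd)
qed

end

end

theory Submission
  imports Defs
begin

text \<open>
  Write \<open>e\<close> for the identity of \<open>N\<close> and \<open>S\<close> for its stabilizer in \<open>G\<close>. In a transitive action, a
  subgroup is transitive exactly when its product with a point stabilizer is the whole group, and
  a transitive subgroup is free exactly when it meets that stabilizer trivially; so regular
  subgroups and complements of the stabilizer are the same thing
  (\<open>regular_iff_complement_stabilizer\<close>). Hence a normal complement of \<open>S\<close> is just a normal
  subgroup of \<open>G\<close> that acts regularly on \<open>N\<close>.

  For a reduced skew bracoid, \<open>\<lambda>\<close> is an isomorphism from \<open>G\<close> onto its image \<open>A\<close>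
  (\<open>lambda_iso\<close>) that respects the actions on \<open>N\<close>. So normality transfers between \<open>G\<close> and \<open>A\<close>,
  and a subgroup \<open>H\<close> of \<open>G\<close> complements \<open>S\<close> exactly when \<open>\<lambda>(H)\<close> is regular
  (\<open>regular_subgroup_lambda_iff\<close>). If \<open>A = R \<rtimes> B\<close> with \<open>R\<close> regular, the preimage of \<open>R\<close> is
  therefore a normal complement of \<open>S\<close>.
  Conversely, a decomposition \<open>G = H \<rtimes> S\<close> maps to \<open>A = \<lambda>(H) \<rtimes> \<lambda>(S)\<close>, where \<open>\<lambda>(H)\<close> is regular
  and \<open>\<lambda>(S)\<close> lies in \<open>Aut(N)\<close> because \<open>S\<close> fixes \<open>e\<close>.
\<close>

lemma internal_semidirect_iso_image:
  assumes iso: "\<phi> \<in> iso G K" and G: "group G" and K: "group K"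
    and GHS: "internal_semidirect G H S"
  shows "internal_semidirect K (\<phi> ` H) (\<phi> ` S)"
proof -
  have H: "H \<lhd> G" and S: "subgroup S G"
    and prod: "carrier G = H <#>\<^bsub>G\<^esub> S" and int: "H \<inter> S = {\<one>\<^bsub>G\<^esub>}"
    using GHS by (auto simp: internal_semidirect_def)
  have hom: "\<phi> \<in> hom G K" and inj: "inj_on \<phi> (carrier G)"
    and surj: "\<phi> ` carrier G = carrier K"
    using iso by (auto simp: iso_def bij_betw_def)
  have sub: "H \<subseteq> carrier G" "S \<subseteq> carrier G"
    using H S by (auto dest: normal_imp_subgroup subgroup.subset)
  have "\<phi> ` H \<inter> \<phi> ` S = \<phi> ` (H \<inter> S)"
    using inj_on_image_Int[OF inj sub] by simp
  also have "\<dots> = {\<one>\<^bsub>K\<^esub>}"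
    using hom_one[OF hom G K] by (simp add: int)
  finally have "\<phi> ` H \<inter> \<phi> ` S = {\<one>\<^bsub>K\<^esub>}" .
  moreover have "carrier K = \<phi> ` H <#>\<^bsub>K\<^esub> \<phi> ` S"
    using set_mult_hom[OF hom sub] surj prod by simp
  ultimately show ?thesis
    using iso_normal_subgroup[OF iso G K H] subgroup.iso_subgroup[OF S G K iso]
    by (simp add: internal_semidirect_def)
qed

text \<open>
  A factorization \<open>g = h s\<close> with \<open>s\<close> fixing \<open>x\<close> amounts to an element \<open>h\<close> of \<open>H\<close> moving \<open>x\<close> to
  \<open>g x\<close>. When such elements exist, every point has the form \<open>k x\<close> with \<open>k \<in> H\<close>, so two elements
  of \<open>H\<close> that agree anywhere yield an element of \<open>H\<close> fixing \<open>x\<close>.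
\<close>

lemma (in transitive_action) regular_iff_complement_stabilizer:
  assumes x: "x \<in> E" and H: "subgroup H G"
  shows "(\<forall>y\<in>E. \<forall>z\<in>E. \<exists>!h. h \<in> H \<and> \<phi> h y = z) \<longleftrightarrow>
    carrier G = H <#> stabilizer G \<phi> x \<and> H \<inter> stabilizer G \<phi> x = {\<one>}"
    (is "?reg \<longleftrightarrow> ?compl")
proof -
  interpret group G using group_hom by (rule group_hom.axioms(1))
  interpret H: subgroup H G by (rule H)
  let ?S = "stabilizer G \<phi> x"
  have one: "\<phi> \<one> y = y" if "y \<in> E" for y
    using that id_eq_one by (metis restrict_apply')
  have one_S: "\<one> \<in> ?S" by (simp add: stabilizer_def one x)
  show ?thesis
  proof
    assume reg: ?reg
    have "g \<in> H <#> ?S" if g: "g \<in> carrier G" for g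
    proof -
      have "\<phi> g x \<in> E" by (rule element_image[OF g x refl])
      then obtain h where h: "h \<in> H" "\<phi> h x = \<phi> g x" using reg x by blast
      have "\<phi> (inv h \<otimes> g) x = \<phi> (inv h) (\<phi> h x)"
        using h g x by (simp add: composition_rule)
      also have "\<dots> = x" by (rule orbit_sym_aux[OF H.mem_carrier[OF h(1)] x refl])
      finally have "inv h \<otimes> g \<in> ?S" using h(1) g by (simp add: stabilizer_def)
      then have "h \<otimes> (inv h \<otimes> g) \<in> H <#> ?S" using h(1) unfolding set_mult_def by blast
      then show ?thesis using h(1) g by (simp add: m_assoc[symmetric])
    qed
    moreover have "H <#> ?S \<subseteq> carrier G"
      by (intro set_mult_closed H.subset) (auto simp: stabilizer_def)
    moreover have "h = \<one>" if h: "h \<in> H" "h \<in> ?S" for h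
      using reg x h one[OF x] H.one_closed by (fastforce simp: stabilizer_def)
    ultimately show ?compl using one_S H.one_closed by blast
  next
    assume compl: ?compl
    have trans: "\<exists>h\<in>H. \<phi> h x = y" if y: "y \<in> E" for y
    proof -
      obtain g where g: "g \<in> carrier G" "\<phi> g x = y" using unique_orbit x y by blast
      then obtain h s where hs: "h \<in> H" "s \<in> ?S" "g = h \<otimes> s"
        using compl unfolding set_mult_def by blast
      then have "\<phi> h x = y" using g x by (auto simp: stabilizer_def composition_rule)
      with hs(1) show ?thesis by blast
    qed
    show ?reg
    proof (intro ballI)
      fix y z assume y: "y \<in> E" and z: "z \<in> E"
      obtain k where k: "k \<in> H" "\<phi> k x = y" using trans y by blast
      obtain l where l: "l \<in> H" "\<phi> l x = z" using trans z by blast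
      have k_inv: "\<phi> (inv k) y = x" by (rule orbit_sym_aux[OF H.mem_carrier[OF k(1)] x k(2)])
      show "\<exists>!h. h \<in> H \<and> \<phi> h y = z"
      proof (rule ex1I)
        show "l \<otimes> inv k \<in> H \<and> \<phi> (l \<otimes> inv k) y = z"
          using k(1) l y k_inv by (simp add: composition_rule)
      next
        fix h assume h: "h \<in> H \<and> \<phi> h y = z"
        \<comment> \<open>Both \<open>h k\<close> and \<open>l\<close> move \<open>x\<close> to \<open>z\<close>.\<close>
        have "\<phi> (inv l \<otimes> (h \<otimes> k)) x = \<phi> (inv l) z"
          using h k l(1) x by (simp add: composition_rule)
        also have "\<dots> = x" by (rule orbit_sym_aux[OF H.mem_carrier[OF l(1)] x l(2)])
        finally have "inv l \<otimes> (h \<otimes> k) \<in> H \<inter> ?S"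
          using h k(1) l(1) by (simp add: stabilizer_def)
        then have "inv l \<otimes> (h \<otimes> k) = \<one>" using compl by blast
        then have "h \<otimes> k = l"
          using h k(1) l(1) by (simp add: inv_solve_left')
        then show "h = l \<otimes> inv k"
          using h k(1) l(1) by (simp add: inv_solve_right)
      qed
    qed
  qed
qed

lemma (in group) hol_aut_subgroup: "subgroup (hol_aut G) (hol G)"
proof -
  have "group_hom (AutoGroup G) (hol G) (\<lambda>\<theta>. (\<one>, \<theta>))"
  proof (rule group_hom.intro[OF AutoGroup group_hol], unfold_locales, rule homI)
    fix \<theta> \<theta>' assume "\<theta> \<in> carrier (AutoGroup G)" "\<theta>' \<in> carrier (AutoGroup G)"
    moreover from this have "\<theta> \<one> = \<one>"
      using hom_one[of \<theta> G G] is_group by (simp add: AutoGroup_simps auto_def)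
    ultimately show "(\<one>, \<theta> \<otimes>\<^bsub>AutoGroup G\<^esub> \<theta>') = (\<one>, \<theta>) \<otimes>\<^bsub>hol G\<^esub> (\<one>, \<theta>')"
      by (simp add: hol_simps)
  qed (simp add: hol_simps)
  from group_hom.img_is_subgroup[OF this] show ?thesis
    by (simp add: hol_aut_def Sigma_def UNION_singleton_eq_range)
qed

context skew_bracoid
begin

lemma lambda_group_hom: "group_hom G (hol N) (bracoid_lambda N act)"
  using G.is_group N.group_hol lambda_hom
  by (simp add: group_hom_def group_hom_axioms_def)

lemma lambda_stabilizer: "bracoid_lambda N act ` stabilizer G act \<one>\<^bsub>N\<^esub> \<subseteq> hol_aut N"
  using gamma_auto by (auto simp: stabilizer_def hol_aut_def bracoid_lambda_def)

end

context reduced_skew_bracoid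
begin

text \<open>
  Since \<open>\<lambda>(g)\<close> acts on \<open>N\<close> as \<open>g\<close> does, \<open>\<lambda>\<close> inherits injectivity from the faithful action.
\<close>

lemma lambda_inj: "inj_on (bracoid_lambda N act) (carrier G)"
  by (rule inj_onI) (metis hol_act_lambda faithful inj_onD)

lemma lambda_iso:
  "bracoid_lambda N act \<in> iso G ((hol N)\<lparr>carrier := bracoid_lambda N act ` carrier G\<rparr>)"
  using lambda_hom lambda_inj by (auto simp: iso_def hom_def bij_betw_def)

lemma regular_subgroup_lambda_iff:
  assumes H: "subgroup H G"
  shows "regular_subgroup (bracoid_lambda N act ` H) N \<longleftrightarrow>
    carrier G = H <#>\<^bsub>G\<^esub> stabilizer G act \<one>\<^bsub>N\<^esub> \<and> H \<inter> stabilizer G act \<one>\<^bsub>N\<^esub> = {\<one>\<^bsub>G\<^esub>}"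
proof -
  let ?l = "bracoid_lambda N act"
  have sub: "h \<in> carrier G" if "h \<in> H" for h
    using subgroup.subset[OF H] that by blast
  have inj: "inj_on ?l H" using lambda_inj sub by (auto intro: inj_on_subset)
  have "(\<exists>!r. r \<in> ?l ` H \<and> hol_act N r \<mu> = \<nu>) \<longleftrightarrow> (\<exists>!h. h \<in> H \<and> act h \<mu> = \<nu>)" for \<mu> \<nu>
  proof
    assume ex1: "\<exists>!r. r \<in> ?l ` H \<and> hol_act N r \<mu> = \<nu>"
    then obtain h where "h \<in> H" "hol_act N (?l h) \<mu> = \<nu>" by blast
    then have h: "h \<in> H" "act h \<mu> = \<nu>" by (simp_all add: hol_act_lambda sub)
    show "\<exists>!h. h \<in> H \<and> act h \<mu> = \<nu>"
    proof (rule ex1I)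
      show "h \<in> H \<and> act h \<mu> = \<nu>" using h by simp
    next
      fix k assume k: "k \<in> H \<and> act k \<mu> = \<nu>"
      have "hol_act N (?l h) \<mu> = \<nu>" "hol_act N (?l k) \<mu> = \<nu>"
        using h k by (simp_all add: hol_act_lambda sub)
      with ex1 h(1) k have "?l k = ?l h" by blast
      then show "k = h" using inj h k by (simp add: inj_on_eq_iff)
    qed
  next
    assume "\<exists>!h. h \<in> H \<and> act h \<mu> = \<nu>"
    then obtain h where h: "h \<in> H" "act h \<mu> = \<nu>"
      and uniq: "\<And>k. k \<in> H \<Longrightarrow> act k \<mu> = \<nu> \<Longrightarrow> k = h" by blast
    show "\<exists>!r. r \<in> ?l ` H \<and> hol_act N r \<mu> = \<nu>"
    proof (rule ex1I)
      show "?l h \<in> ?l ` H \<and> hol_act N (?l h) \<mu> = \<nu>"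
        using h by (simp add: hol_act_lambda sub)
    next
      fix r assume "r \<in> ?l ` H \<and> hol_act N r \<mu> = \<nu>"
      then obtain k where k: "k \<in> H" "r = ?l k" "hol_act N (?l k) \<mu> = \<nu>" by blast
      then have "act k \<mu> = \<nu>" by (simp add: hol_act_lambda sub)
      with uniq k show "r = ?l h" by simp
    qed
  qed
  moreover have "subgroup (?l ` H) (hol N)"
    using group_hom.subgroup_img_is_subgroup[OF lambda_group_hom H] .
  ultimately show ?thesis
    using regular_iff_complement_stabilizer[OF N.one_closed H]
    by (simp add: regular_subgroup_def)
qed

end

theorem proposition4p2:
  fixes G :: "('a, 'c) monoid_scheme" and N :: "('b, 'd) monoid_scheme"
    and act :: "'a \<Rightarrow> 'b \<Rightarrow> 'b"
  assumes "reduced_skew_bracoid G N act"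
  defines "A \<equiv> bracoid_lambda N act ` carrier G"
  shows "(\<exists>R B. internal_semidirect ((hol N)\<lparr>carrier := A\<rparr>) R B \<and>
            regular_subgroup R N \<and> subgroup B ((hol N)\<lparr>carrier := hol_aut N\<rparr>))
         \<longleftrightarrow> almost_brace G N act"
proof -
  interpret reduced_skew_bracoid G N act by fact
  interpret hol: group "hol N" by (rule N.group_hol)
  let ?l = "bracoid_lambda N act" and ?S = "stabilizer G act \<one>\<^bsub>N\<^esub>"
  let ?K = "(hol N)\<lparr>carrier := A\<rparr>"
  have A: "subgroup A (hol N)"
    unfolding A_def by (rule group_hom.img_is_subgroup[OF lambda_group_hom])
  have K: "group ?K" using A by (rule hol.subgroup_imp_group)
  have iso: "?l \<in> iso G ?K" unfolding A_def by (rule lambda_iso)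
  have S: "subgroup ?S G" using stabilizer_subgroup by simp
  show ?thesis
  proof
    assume "\<exists>R B. internal_semidirect ?K R B \<and> regular_subgroup R N \<and>
      subgroup B ((hol N)\<lparr>carrier := hol_aut N\<rparr>)"
    then obtain R where R: "R \<lhd> ?K" "regular_subgroup R N"
      by (auto simp: internal_semidirect_def)
    define H where "H = inv_into (carrier G) ?l ` R"
    have H: "H \<lhd> G"
      unfolding H_def using G.iso_set_sym[OF iso] K G.is_group R(1) by (rule iso_normal_subgroup)
    have "R \<subseteq> ?l ` carrier G"
      using subgroup.subset[OF normal_imp_subgroup[OF R(1)]] by (simp add: A_def)
    then have "?l ` H = R" by (simp add: H_def image_inv_into_cancel)
    then have "internal_semidirect G H ?S"
      using regular_subgroup_lambda_iff[OF normal_imp_subgroup[OF H]] R(2) H S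
      by (simp add: internal_semidirect_def)
    then show "almost_brace G N act" by unfold_locales blast
  next
    assume "almost_brace G N act"
    then obtain H where H: "internal_semidirect G H ?S"
      using almost_brace.normal_complement by blast
    have "regular_subgroup (?l ` H) N"
      using H regular_subgroup_lambda_iff[of H]
      by (simp add: internal_semidirect_def normal_imp_subgroup)
    moreover have "subgroup (?l ` ?S) ((hol N)\<lparr>carrier := hol_aut N\<rparr>)"
      using group_hom.subgroup_img_is_subgroup[OF lambda_group_hom S] N.hol_aut_subgroup
        lambda_stabilizer
      by (rule hol.subgroup_incl)
    ultimately show "\<exists>R B. internal_semidirect ?K R B \<and> regular_subgroup R N \<and>
      subgroup B ((hol N)\<lparr>carrier := hol_aut N\<rparr>)"
      using internal_semidirect_iso_image[OF iso G.is_group K H] by blast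
  qed
qed

end
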